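(* Let $\Gamma$ be a finite extensive game. Every game with awareness of unawareness $\Gamma^*=(\mathcal{G},\Gamma^m,\mathcal{F})$ based on $\Gamma$ has a generalized Nash equilibrium.
   Context: Extensive games. A finite extensive game is $\Gamma=(N,M,H,P,f_c,\{\mathcal{I}_i\}_{i\in N},\{u_i\}_{i\in N})$: $N$ finite set of players; $M$ finite set of moves; $H$ finite prefix-closed set of finite move sequences (histories); $Z$ the runs (histories not strict prefixes of others); $M_h=\{m:h\cdot\langle m\rangle\in H\}$; $P:H\setminus Z\to N\cup\{c\}$ ($c$ = nature); $H_i=P^{-1}(i)$; $f_c(\cdot\mid h)$ a probability measure on $M_h$ when $P(h)=c$; $\mathcal{I}_i$ a partition of $H_i$ into information sets with $M_h=M_{h'}$ within a cell; $u_i:Z\to\mathbb{R}$. Perfect recall: if $h,h'$ are in the same $i$-information set and $h_1$ is a prefix of $h$ with $P(h_1)=i$, there is a prefix $h_1'$ of $h'$ in the same information set as $h_1$, and if $h_1\cdot\langle m\rangle$ is a prefix of $h$ then $h_1'\cdot\langle m\rangle$ is a prefix of $h'$. Components of $\Gamma^s$ carry superscript $s$. Virtual histories. For a tuple $\Gamma^+=(N^+,M^+,H^+,P^+,f_c^+,\{\mathcal{I}^+_i\},\{u_i^+\},\{A_i^+\}_{i\in N^+})$ the set $V^+$ of virtual histories is defined inductively: (1) if $\langle m\rangle\in H^+$, $m\in M^+\setminus M$, and either $P^+(\langle\rangle)\in N^+$ or $P^+(\langle\rangle)=c=P(\langle\rangle)$, then $\langle m\rangle\in V^+$; (2) if $h\cdot\langle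 m\rangle\in H^+$ and $h\in V^+$ then $h\cdot\langle m\rangle\in V^+$; (3) if $h\cdot\langle m\rangle\in H^+$, $m\in M^+\setminus M$, $h\notin V^+$, and either $P^+(h)\in N^+$ or $P^+(h)=c=P(\overline h)$, then $h\cdot\langle m\rangle\in V^+$. Here for $h\notin V^+$, $\overline h$ is the subsequence of moves of $h$ lying in $M$, and for $h\in V^+$, $\overline h=h$. Augmented games (with awareness of unawareness). An augmented game based on $\Gamma$ is such a $\Gamma^+$ satisfying: (A1) without the $A^+_i$ it is a finite extensive game with perfect recall; (A2) $A_i^+:H_i^+\to 2^H$, each $A_i^+(h)$ a prefix-closed set of histories of $\Gamma$; (A3) $N^+\subseteq N$; (A4$'$) if $P^+(h)\in N^+$ and $h\notin V^+$ then $P^+(h)=P(\overline h)$ and $M^+_h\subseteq M_{\overline h}\cup(M^+\setminus M)$; (A5$'$) if $P^+(h)=c$ and $h\notin V^+$ then either $P(\overline h)=c$ and $M^+_h\subseteq M_{\overline h}\cup(M^+\setminus M)$, or $P(\overline h)\neq c$ and $M^+_h\cap M=\emptyset$; (A6) $h,h'$ in the same information set of $\mathcal{I}^+_i$ implies $A^+_i(h)=A^+_i(h')$; (A7) if $h$ is a prefix of $h'$ and $P^+(h)=P^+(h')=i$ then $A^+_i(h)\subseteq A^+_i(h')$; (A8$'$) if $h,h'$ are in the same information set of $\Gamma^+$ and $h,h'\notin V^+$, then $\overline h,\overline{h'}$ are in the same information set of $\Gamma$; (A9) if $h,h'$ are histories of both $\Gamma^+$ and $\Gamma$ and are in the same information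 set of $\Gamma$, they are in the same information set of $\Gamma^+$; (A10) for $i\in N^+$, $h\in H_i^+$, if $h',h''\in A_i^+(h)$ are in the same information set of $\Gamma$ then $h'\cdot\langle m\rangle\in A_i^+(h)$ iff $h''\cdot\langle m\rangle\in A_i^+(h)$; (A12) for $i\in N^+$, $z\in Z^+$ with $\overline z\in Z$, $u^+_i(z)=u_i(\overline z)$. An augmented game without awareness of unawareness additionally satisfies (A4) if $P^+(h)\in N^+$ then $P^+(h)=P(\overline h)$ and $M^+_h\subseteq M_{\overline h}$; (A5) if $P^+(h)=c$ then either $P(\overline h)=c$ and $M^+_h\subseteq M_{\overline h}$, or $M^+_h\cap M=\emptyset$; (A8) $h,h'$ in the same information set of $\Gamma^+$ implies $\overline h,\overline{h'}$ in the same information set of $\Gamma$; (A11) $\{\overline z:z\in Z^+\}\subseteq Z$ and for $i\in N^+$, $h\in H^+_i$, every element of $A^+_i(h)$ not a strict prefix of another element of $A^+_i(h)$ lies in $Z$ (in such a game $V^+=\emptyset$). Games with awareness of unawareness. $\Gamma^*=(\mathcal{G},\Gamma^m,\mathcal{F})$ where $\mathcal{G}$ is a countable set of augmented games based on $\Gamma$, $\Gamma^m\in\mathcal{G}$ is an augmented game without awareness of unawareness satisfying (M1) $N^m=N$, (M2) $M\subseteq M^m$ and $\{\overline z:z\in Z^m\}=Z$, (M3) if $P^m(h)\in N$ then $M^m_h=M_{\overline h}$, and if $P^m(h)=c$ then either $M^m_h\cap M=\emptyset$ or ($M^m_h=M_{\overline h}$ and $f^m_c(\cdot\mid h)=f_c(\cdot\mid\overline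 h)$); and $\mathcal{F}$ maps each $(\Gamma^+,h)$ with $\Gamma^+\in\mathcal{G}$, $P^+(h)=i\in N^+$ to $(\Gamma^h,I)$, $\Gamma^h\in\mathcal{G}$, $I$ an $i$-information set of $\Gamma^h$, such that for all $\Gamma^+\in\mathcal{G}$, $h\in H^+$ with $P^+(h)=i$, $A_i^+(h)=a$, $\mathcal{F}(\Gamma^+,h)=(\Gamma^h,I)$: (C1$'$) $\{\overline{h'}:h'\in H^h,h'\notin V^h\}=a$; (C2$'$) if $h'\in H^h$ and $P^h(h')=j$ then (a) $A^h_j(h')\subseteq a$, (b) if $h'\notin V^h$ then $M^h_{h'}=(M_{\overline{h'}}\cap\{m:\overline{h'}\cdot\langle m\rangle\in a\})\cup(M^h_{h'}\setminus M_{\overline{h'}})$, (c) if $\mathcal{F}(\Gamma^h,h')=(\Gamma',I')$ then $M'_{h''}\subseteq M^h_{h'}$ for all $h''\in I'$; (C3) if $h'$ is in the same information set as $h$ in $\Gamma^+$ and $\overline{h'}\in a$, some $h''\in I$ has $\overline{h''}=\overline{h'}$; (C4) if $h'\in I$ then $A^h_i(h')=a$ and $\mathcal{F}(\Gamma^h,h')=(\Gamma^h,I)$; (C5) if $h'\in H^+$, $P^+(h')=i$, $A^+_i(h')=a$: if $h,h'$ are in the same information set of $\Gamma^+$ then $\mathcal{F}(\Gamma^+,h')=(\Gamma^h,I)$, and if $h$ is a prefix or suffix of $h'$ then $\mathcal{F}(\Gamma^+,h')=(\Gamma^h,I')$ for some $i$-information set $I'$; (C6$'$) if $h'\in I$,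 $h'\notin V^h$ and $h$ is not virtual, then $\overline h,\overline{h'}$ are in the same information set of $\Gamma$; (C7) if $\Gamma^h=\Gamma^+$ then $h'\in I$ iff $h,h'$ are in the same $i$-information set of $\Gamma^+$; (C8) for every $h'\in I$: a prefix $h'_1$ of $h'$ with $P^h(h'_1)=i$ and $\mathcal{F}(\Gamma^h,h'_1)=(\Gamma',I')$ exists iff a prefix $h_1$ of $h$ with $P^+(h_1)=i$ and $\mathcal{F}(\Gamma^+,h_1)=(\Gamma',I')$ exists; moreover $h'_1\cdot\langle m\rangle$ is a prefix of $h'$ iff $h_1\cdot\langle m\rangle$ is a prefix of $h$; (C9) some $h'\in I$ is such that for every prefix $h''\cdot\langle m\rangle$ of $h'$ with $P^h(h'')=j\in N^h$ and $\mathcal{F}(\Gamma^h,h'')=(\Gamma',I')$, $h_1\cdot\langle m\rangle\in H'$ for all $h_1\in I'$; (C10) histories of both $\Gamma^+$ and $\Gamma^h$ are in the same $i$-information set of $\Gamma^+$ iff they are in the same $i$-information set of $\Gamma^h$. Local strategies and equilibrium. $\mathcal{G}_i$ is the set of $\Gamma'\in\mathcal{G}$ with $\mathcal{F}(\Gamma^+,h)=(\Gamma',\cdot)$ for some $\Gamma^+\in\mathcal{G}$, $h$ with $P^+(h)=i$. $(\Gamma_1,h_1)\sim_i(\Gamma_2,h_2)$ iff $\mathcal{F}(\Gamma_1,h_1)=\mathcal{F}(\Gamma_2,h_2)$. A local strategy $\sigma_{i,\Gamma'}$ ($\Gamma'\in\mathcal{G}_i$) maps each $(\Gamma^+,h)$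 with $P^+(h)=i$, $\mathcal{F}(\Gamma^+,h)=(\Gamma',I)$ to a probability distribution over $M'_{h'}$ ($h'\in I$), constant on $\sim_i$-classes. A generalized strategy profile is $\vec\sigma=\{\sigma_{i,\Gamma'}:i\in N,\Gamma'\in\mathcal{G}_i\}$. $EU_{i,\Gamma'}(\vec\sigma)=\sum_{z\in Z'}\Pr(z)u'_i(z)$, where runs of $\Gamma'$ are generated by nature moving by $f'_c$ and, at $h$ with $P'(h)=j$, $\mathcal{F}(\Gamma',h)=(\Gamma'',\cdot)$, the move drawn from $\sigma_{j,\Gamma''}(\Gamma',h)$. $\vec\sigma^*$ is a generalized Nash equilibrium if for every $i$, $\Gamma'\in\mathcal{G}_i$ and local strategy $\sigma$ for $i$ in $\Gamma'$, $EU_{i,\Gamma'}(\vec\sigma^* )\ge EU_{i,\Gamma'}((\vec\sigma^*_{-(i,\Gamma')},\sigma))$. *)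

theory Defs
  imports Complex_Main "HOL-Library.Sublist" "HOL-Library.Countable_Set"
begin

datatype 'n agent = Player 'n | Chance

text \<open>Histories are lists of moves; h . <m> is written h @ [m].\<close>
record ('n, 'm) game =
  N    :: "'n set"
  M    :: "'m set"
  H    :: "'m list set"
  P    :: "'m list \<Rightarrow> 'n agent"          (* player function, meaningful on H - Z *)
  fc   :: "'m list \<Rightarrow> 'm \<Rightarrow> real"
  Info :: "'n \<Rightarrow> 'm list set set"
  u    :: "'n \<Rightarrow> 'm list \<Rightarrow> real"

record ('n, 'm) aug = "('n, 'm) game" +
  A :: "'n \<Rightarrow> 'm list \<Rightarrow> 'm list set"

definition Z :: "('n, 'm, 'z) game_scheme \<Rightarrow> 'm list set" where
  "Z G = {h \<in> H G. \<not> (\<exists>h' \<in> H G. strict_prefix h h')}"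

definition moves :: "('n, 'm, 'z) game_scheme \<Rightarrow> 'm list \<Rightarrow> 'm set" where
  "moves G h = {m. h @ [m] \<in> H G}"

definition Hi :: "('n, 'm, 'z) game_scheme \<Rightarrow> 'n \<Rightarrow> 'm list set" where
  "Hi G i = {h \<in> H G - Z G. P G h = Player i}"

definition same_info :: "('n, 'm, 'z) game_scheme \<Rightarrow> 'm list \<Rightarrow> 'm list \<Rightarrow> bool" where
  "same_info G h h' \<longleftrightarrow> (\<exists>i. \<exists>I \<in> Info G i. h \<in> I \<and> h' \<in> I)"

definition same_info_of :: "('n, 'm, 'z) game_scheme \<Rightarrow> 'n \<Rightarrow> 'm list \<Rightarrow> 'm list \<Rightarrow> bool" where
  "same_info_of G i h h' \<longleftrightarrow> (\<exists>I \<in> Info G i. h \<in> I \<and> h' \<in> I)"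

definition prefix_closed :: "'m list set \<Rightarrow> bool" where
  "prefix_closed S \<longleftrightarrow> (\<forall>h \<in> S. \<forall>h'. prefix h' h \<longrightarrow> h' \<in> S)"

definition is_dist :: "('m \<Rightarrow> real) \<Rightarrow> 'm set \<Rightarrow> bool" where
  "is_dist d S \<longleftrightarrow> (\<forall>m. 0 \<le> d m) \<and> (\<forall>m. m \<notin> S \<longrightarrow> d m = 0) \<and> sum d S = 1"

definition extensive_game :: "('n, 'm, 'z) game_scheme \<Rightarrow> bool" where
  "extensive_game G \<longleftrightarrow>
     finite (N G) \<and> finite (M G) \<and> finite (H G) \<and>
     [] \<in> H G \<and> prefix_closed (H G) \<and>
     (\<forall>h \<in> H G. set h \<subseteq> M G) \<and>
     (\<forall>h \<in> H G - Z G. P G h \<in> Player ` N G \<or> P G h = Chance) \<and>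
     (\<forall>h \<in> H G - Z G. P G h = Chance \<longrightarrow> is_dist (fc G h) (moves G h)) \<and>
     (\<forall>i. \<Union> (Info G i) = Hi G i \<and> {} \<notin> Info G i \<and>
          (\<forall>I \<in> Info G i. \<forall>J \<in> Info G i. I \<noteq> J \<longrightarrow> I \<inter> J = {}) \<and>
          (\<forall>I \<in> Info G i. \<forall>h \<in> I. \<forall>h' \<in> I. moves G h = moves G h'))"

definition perfect_recall :: "('n, 'm, 'z) game_scheme \<Rightarrow> bool" where
  "perfect_recall G \<longleftrightarrow>
     (\<forall>i. \<forall>I \<in> Info G i. \<forall>h \<in> I. \<forall>h' \<in> I. \<forall>h1.
        prefix h1 h \<and> P G h1 = Player i \<longrightarrow>
        (\<exists>h1'. prefix h1' h' \<and> same_info_of G i h1 h1' \<and>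
               (\<forall>m. prefix (h1 @ [m]) h \<longrightarrow> prefix (h1' @ [m]) h')))"

text \<open>Virtual histories of Gp relative to the base game G, defined by recursion on
  length (on the reversed history), exactly following the inductive clauses (1)-(3):
  h @ [m] is virtual iff it is a history of Gp and either h is virtual (clause 2) or
  h is not virtual, m is a new move and the player condition holds (clauses 1, 3;
  clause 1 is the case h = [], where the bar of [] is []).\<close>
fun virt_rev :: "('n, 'm, 'z) game_scheme \<Rightarrow> ('n, 'm, 'y) game_scheme \<Rightarrow> 'm list \<Rightarrow> bool" where
  "virt_rev G Gp [] = False"
| "virt_rev G Gp (m # rh) =
     (rev (m # rh) \<in> H Gp \<and>
      (virt_rev G Gp rh \<or>
       (m \<in> M Gp - M G \<and>
        (P Gp (rev rh) \<in> Player ` N Gp \<or>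
         (P Gp (rev rh) = Chance \<and> P G (filter (\<lambda>x. x \<in> M G) (rev rh)) = Chance)))))"

definition virtual :: "('n, 'm, 'z) game_scheme \<Rightarrow> ('n, 'm, 'y) game_scheme \<Rightarrow> 'm list \<Rightarrow> bool" where
  "virtual G Gp h = virt_rev G Gp (rev h)"

definition bar :: "('n, 'm, 'z) game_scheme \<Rightarrow> ('n, 'm, 'y) game_scheme \<Rightarrow> 'm list \<Rightarrow> 'm list" where
  "bar G Gp h = (if virtual G Gp h then h else filter (\<lambda>x. x \<in> M G) h)"

definition augmented :: "('n, 'm) game \<Rightarrow> ('n, 'm) aug \<Rightarrow> bool" where
  "augmented G Gp \<longleftrightarrow>
     \<comment> \<open>A1\<close>
     extensive_game Gp \<and> perfect_recall Gp \<and>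
     \<comment> \<open>A2\<close>
     (\<forall>i. \<forall>h \<in> Hi Gp i. A Gp i h \<subseteq> H G \<and> prefix_closed (A Gp i h)) \<and>
     \<comment> \<open>A3\<close>
     N Gp \<subseteq> N G \<and>
     \<comment> \<open>A4'\<close>
     (\<forall>h \<in> H Gp - Z Gp. P Gp h \<in> Player ` N Gp \<and> \<not> virtual G Gp h \<longrightarrow>
        P Gp h = P G (bar G Gp h) \<and>
        moves Gp h \<subseteq> moves G (bar G Gp h) \<union> (M Gp - M G)) \<and>
     \<comment> \<open>A5'\<close>
     (\<forall>h \<in> H Gp - Z Gp. P Gp h = Chance \<and> \<not> virtual G Gp h \<longrightarrow>
        (P G (bar G Gp h) = Chance \<and> moves Gp h \<subseteq> moves G (bar G Gp h) \<union> (M Gp - M G)) \<or>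
        (P G (bar G Gp h) \<noteq> Chance \<and> moves Gp h \<inter> M G = {})) \<and>
     \<comment> \<open>A6\<close>
     (\<forall>i. \<forall>I \<in> Info Gp i. \<forall>h \<in> I. \<forall>h' \<in> I. A Gp i h = A Gp i h') \<and>
     \<comment> \<open>A7\<close>
     (\<forall>i h h'. prefix h h' \<and> h \<in> Hi Gp i \<and> h' \<in> Hi Gp i \<longrightarrow> A Gp i h \<subseteq> A Gp i h') \<and>
     \<comment> \<open>A8'\<close>
     (\<forall>h h'. same_info Gp h h' \<and> \<not> virtual G Gp h \<and> \<not> virtual G Gp h' \<longrightarrow>
        same_info G (bar G Gp h) (bar G Gp h')) \<and>
     \<comment> \<open>A9\<close>
     (\<forall>h \<in> H Gp \<inter> H G. \<forall>h' \<in> H Gp \<inter> H G. same_info G h h' \<longrightarrow> same_info Gp h h') \<and>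
     \<comment> \<open>A10\<close>
     (\<forall>i \<in> N Gp. \<forall>h \<in> Hi Gp i. \<forall>h' \<in> A Gp i h. \<forall>h'' \<in> A Gp i h.
        same_info G h' h'' \<longrightarrow> (\<forall>m. h' @ [m] \<in> A Gp i h \<longleftrightarrow> h'' @ [m] \<in> A Gp i h)) \<and>
     \<comment> \<open>A12\<close>
     (\<forall>i \<in> N Gp. \<forall>z \<in> Z Gp. bar G Gp z \<in> Z G \<longrightarrow> u Gp i z = u G i (bar G Gp z))"

definition augmented_no_aou :: "('n, 'm) game \<Rightarrow> ('n, 'm) aug \<Rightarrow> bool" where
  "augmented_no_aou G Gp \<longleftrightarrow>
     augmented G Gp \<and>
     \<comment> \<open>A4\<close>
     (\<forall>h \<in> H Gp - Z Gp. P Gp h \<in> Player ` N Gp \<longrightarrow>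
        P Gp h = P G (bar G Gp h) \<and> moves Gp h \<subseteq> moves G (bar G Gp h)) \<and>
     \<comment> \<open>A5\<close>
     (\<forall>h \<in> H Gp - Z Gp. P Gp h = Chance \<longrightarrow>
        (P G (bar G Gp h) = Chance \<and> moves Gp h \<subseteq> moves G (bar G Gp h)) \<or>
        moves Gp h \<inter> M G = {}) \<and>
     \<comment> \<open>A8\<close>
     (\<forall>h h'. same_info Gp h h' \<longrightarrow> same_info G (bar G Gp h) (bar G Gp h')) \<and>
     \<comment> \<open>A11\<close>
     bar G Gp ` Z Gp \<subseteq> Z G \<and>
     (\<forall>i \<in> N Gp. \<forall>h \<in> Hi Gp i. \<forall>x \<in> A Gp i h.
        \<not> (\<exists>y \<in> A Gp i h. strict_prefix x y) \<longrightarrow> x \<in> Z G)"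

type_synonym ('n, 'm) Fmap = "('n, 'm) aug \<Rightarrow> 'm list \<Rightarrow> ('n, 'm) aug \<times> 'm list set"

definition game_aou ::
  "('n, 'm) game \<Rightarrow> ('n, 'm) aug set \<Rightarrow> ('n, 'm) aug \<Rightarrow> ('n, 'm) Fmap \<Rightarrow> bool" where
  "game_aou G GG Gm F \<longleftrightarrow>
     countable GG \<and> (\<forall>Gp \<in> GG. augmented G Gp) \<and>
     Gm \<in> GG \<and> augmented_no_aou G Gm \<and>
     \<comment> \<open>M1\<close>
     N Gm = N G \<and>
     \<comment> \<open>M2\<close>
     M G \<subseteq> M Gm \<and> bar G Gm ` Z Gm = Z G \<and>
     \<comment> \<open>M3\<close>
     (\<forall>h \<in> H Gm - Z Gm.
        (P Gm h \<in> Player ` N G \<longrightarrow> moves Gm h = moves G (bar G Gm h)) \<and>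
        (P Gm h = Chance \<longrightarrow>
           moves Gm h \<inter> M G = {} \<or>
           (moves Gm h = moves G (bar G Gm h) \<and>
            (\<forall>m. fc Gm h m = fc G (bar G Gm h) m)))) \<and>
     \<comment> \<open>F maps (Gp, h) with P Gp h = i to a game of GG and an i-information set of it\<close>
     (\<forall>Gp \<in> GG. \<forall>i. \<forall>h \<in> Hi Gp i.
        fst (F Gp h) \<in> GG \<and> snd (F Gp h) \<in> Info (fst (F Gp h)) i) \<and>
     (\<forall>Gp \<in> GG. \<forall>i. \<forall>h \<in> Hi Gp i.
        let a = A Gp i h; Gh = fst (F Gp h); I = snd (F Gp h) in
        \<comment> \<open>C1'\<close>
        {bar G Gh h' | h'. h' \<in> H Gh \<and> \<not> virtual G Gh h'} = a \<and>
        \<comment> \<open>C2'\<close>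
        (\<forall>h' \<in> H Gh - Z Gh. \<forall>j. P Gh h' = Player j \<longrightarrow>
           A Gh j h' \<subseteq> a \<and>
           (\<not> virtual G Gh h' \<longrightarrow>
              moves Gh h' = (moves G (bar G Gh h') \<inter> {m. bar G Gh h' @ [m] \<in> a}) \<union>
                            (moves Gh h' - moves G (bar G Gh h'))) \<and>
           (\<forall>h'' \<in> snd (F Gh h'). moves (fst (F Gh h')) h'' \<subseteq> moves Gh h')) \<and>
        \<comment> \<open>C3\<close>
        (\<forall>h'. same_info Gp h h' \<and> bar G Gp h' \<in> a \<longrightarrow>
           (\<exists>h'' \<in> I. bar G Gh h'' = bar G Gp h')) \<and>
        \<comment> \<open>C4\<close>
        (\<forall>h' \<in> I. A Gh i h' = a \<and> F Gh h' = (Gh, I)) \<and>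
        \<comment> \<open>C5\<close>
        (\<forall>h' \<in> Hi Gp i. A Gp i h' = a \<longrightarrow>
           (same_info Gp h h' \<longrightarrow> F Gp h' = (Gh, I)) \<and>
           (prefix h h' \<or> prefix h' h \<longrightarrow>
              (\<exists>I'. I' \<in> Info Gh i \<and> F Gp h' = (Gh, I')))) \<and>
        \<comment> \<open>C6'\<close>
        (\<forall>h' \<in> I. \<not> virtual G Gh h' \<and> \<not> virtual G Gp h \<longrightarrow>
           same_info G (bar G Gp h) (bar G Gh h')) \<and>
        \<comment> \<open>C7\<close>
        (Gh = Gp \<longrightarrow> (\<forall>h'. h' \<in> I \<longleftrightarrow> same_info_of Gp i h h')) \<and>
        \<comment> \<open>C8\<close>
        (\<forall>h' \<in> I.
           (\<forall>G' I'.
              (\<exists>h1'. prefix h1' h' \<and> P Gh h1' = Player i \<and> F Gh h1' = (G', I')) \<longleftrightarrow>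
              (\<exists>h1. prefix h1 h \<and> P Gp h1 = Player i \<and> F Gp h1 = (G', I'))) \<and>
           (\<forall>G' I' h1' h1.
              prefix h1' h' \<and> P Gh h1' = Player i \<and> F Gh h1' = (G', I') \<and>
              prefix h1 h \<and> P Gp h1 = Player i \<and> F Gp h1 = (G', I') \<longrightarrow>
              (\<forall>m. prefix (h1' @ [m]) h' \<longleftrightarrow> prefix (h1 @ [m]) h))) \<and>
        \<comment> \<open>C9\<close>
        (\<exists>h' \<in> I. \<forall>h'' m j. prefix (h'' @ [m]) h' \<and> P Gh h'' = Player j \<and> j \<in> N Gh \<longrightarrow>
           (\<forall>h1 \<in> snd (F Gh h''). h1 @ [m] \<in> H (fst (F Gh h'')))) \<and>
        \<comment> \<open>C10\<close>
        (\<forall>x \<in> H Gp \<inter> H Gh. \<forall>y \<in> H Gp \<inter> H Gh.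
           same_info_of Gp i x y \<longleftrightarrow> same_info_of Gh i x y))"

definition Games_of :: "('n, 'm) aug set \<Rightarrow> ('n, 'm) Fmap \<Rightarrow> 'n \<Rightarrow> ('n, 'm) aug set" where
  "Games_of GG F i = {G'. \<exists>Gp \<in> GG. \<exists>h \<in> Hi Gp i. fst (F Gp h) = G'}"

type_synonym ('n, 'm) local_strat = "('n, 'm) aug \<Rightarrow> 'm list \<Rightarrow> 'm \<Rightarrow> real"

definition local_strategy ::
  "('n, 'm) aug set \<Rightarrow> ('n, 'm) Fmap \<Rightarrow> 'n \<Rightarrow> ('n, 'm) aug \<Rightarrow> ('n, 'm) local_strat \<Rightarrow> bool" where
  "local_strategy GG F i G' s \<longleftrightarrow>
     (\<forall>Gp \<in> GG. \<forall>h \<in> Hi Gp i. fst (F Gp h) = G' \<longrightarrow>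
        (\<forall>h' \<in> snd (F Gp h). is_dist (s Gp h) (moves G' h'))) \<and>
     (\<forall>G1 \<in> GG. \<forall>h1 \<in> Hi G1 i. \<forall>G2 \<in> GG. \<forall>h2 \<in> Hi G2 i.
        fst (F G1 h1) = G' \<and> F G1 h1 = F G2 h2 \<longrightarrow> s G1 h1 = s G2 h2)"

type_synonym ('n, 'm) profile = "'n \<Rightarrow> ('n, 'm) aug \<Rightarrow> ('n, 'm) local_strat"

definition gen_profile ::
  "('n, 'm) game \<Rightarrow> ('n, 'm) aug set \<Rightarrow> ('n, 'm) Fmap \<Rightarrow> ('n, 'm) profile \<Rightarrow> bool" where
  "gen_profile G GG F \<sigma> \<longleftrightarrow>
     (\<forall>i \<in> N G. \<forall>G' \<in> Games_of GG F i. local_strategy GG F i G' (\<sigma> i G'))"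

definition step_prob :: "('n, 'm) Fmap \<Rightarrow> ('n, 'm) profile \<Rightarrow> ('n, 'm) aug \<Rightarrow> 'm list \<Rightarrow> 'm \<Rightarrow> real" where
  "step_prob F \<sigma> G' h m =
     (case P G' h of Chance \<Rightarrow> fc G' h m
                   | Player j \<Rightarrow> \<sigma> j (fst (F G' h)) G' h m)"

definition run_prob :: "('n, 'm) Fmap \<Rightarrow> ('n, 'm) profile \<Rightarrow> ('n, 'm) aug \<Rightarrow> 'm list \<Rightarrow> real" where
  "run_prob F \<sigma> G' z = (\<Prod>k < length z. step_prob F \<sigma> G' (take k z) (z ! k))"

definition EU :: "('n, 'm) Fmap \<Rightarrow> ('n, 'm) profile \<Rightarrow> 'n \<Rightarrow> ('n, 'm) aug \<Rightarrow> real" where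
  "EU F \<sigma> i G' = (\<Sum>z \<in> Z G'. run_prob F \<sigma> G' z * u G' i z)"

definition gen_nash ::
  "('n, 'm) game \<Rightarrow> ('n, 'm) aug set \<Rightarrow> ('n, 'm) Fmap \<Rightarrow> ('n, 'm) profile \<Rightarrow> bool" where
  "gen_nash G GG F \<sigma> \<longleftrightarrow>
     gen_profile G GG F \<sigma> \<and>
     (\<forall>i \<in> N G. \<forall>G' \<in> Games_of GG F i. \<forall>s. local_strategy GG F i G' s \<longrightarrow>
        EU F \<sigma> i G' \<ge> EU F (\<sigma>(i := (\<sigma> i)(G' := s))) i G')"

end

theory Submission
  imports Defs "HOL-Complex_Analysis.Great_Picard"
begin

text \<open>Split every pair (player, game) into agents, one for each information set of the player in
  the game. In a countable product of simplices, Nash's map for the counterfactual values of the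
  agents' moves has a fixed point, because the Hilbert cube has the fixed point property. There
  every agent plays moves of maximal counterfactual value only. The change in
  expected utility caused by a deviation of a pair (player, game) telescopes into a sum over its
  information sets of the deviation's own reaching weight times the gain in counterfactual
  value; perfect recall makes that weight, which is nonnegative, a function of the information
  set, so no deviation is profitable.\<close>

subsection \<open>Fixed points in countable products of simplices\<close>

text \<open>Continuity is stated through pointwise limits, that is, in the product topology. Kuhn's
  combinatorial lemma is applied in dimension \<open>n\<close> on the grid of mesh \<open>1/n\<close>, with the remaining
  coordinates set to zero; a diagonal subsequence of the approximate fixed points converges to
  a fixed point.\<close>

lemma Hilbert_cube_fixpoint:
  fixes f :: "(nat \<Rightarrow> real) \<Rightarrow> nat \<Rightarrow> real"
  assumes maps: "\<And>x i. (\<forall>j. x j \<in> {0..1}) \<Longrightarrow> f x i \<in> {0..1}"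
    and cont: "\<And>X x i. (\<And>n j. X n j \<in> {0..1}) \<Longrightarrow> (\<And>j. (\<lambda>n. X n j) \<longlonglongrightarrow> x j) \<Longrightarrow>
                 (\<lambda>n. f (X n) i) \<longlonglongrightarrow> f x i"
  obtains x where "\<And>j. x j \<in> {0..1}" "f x = x"
proof -
  define cube where "cube = (\<lambda>x::nat \<Rightarrow> real. \<forall>j. x j \<in> {0..1})"
  \<comment> \<open>Capping at 1 puts \<open>grid p v\<close> in the cube for every
    \<open>v\<close>, with no bound on \<open>v\<close> to carry along.\<close>
  define grid where "grid = (\<lambda>p (v::nat \<Rightarrow> nat) j. if j < p then min 1 (real (v j) / real p) else 0)"
  have grid_cube: "cube (grid p v)" for p v
    by (auto simp: cube_def grid_def)
  \<comment> \<open>Label 0 at a coordinate means that \<open>f\<close> does not lower it, label 1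
    that \<open>f\<close> does not raise it; on the faces of the cube the label is forced, as Kuhn's
    lemma demands.\<close>
  obtain l :: "(nat \<Rightarrow> real) \<Rightarrow> nat \<Rightarrow> nat" where l:
    "\<And>x i. l x i \<le> 1"
    "\<And>x i. cube x \<Longrightarrow> x i = 0 \<Longrightarrow> l x i = 0"
    "\<And>x i. cube x \<Longrightarrow> x i = 1 \<Longrightarrow> l x i = 1"
    "\<And>x i. cube x \<Longrightarrow> l x i = 0 \<Longrightarrow> x i \<le> f x i"
    "\<And>x i. cube x \<Longrightarrow> l x i = 1 \<Longrightarrow> f x i \<le> x i"
  proof -
    have "\<forall>x. cube x \<longrightarrow> cube (f x)" "\<forall>x. cube x \<longrightarrow> (\<forall>i. True \<longrightarrow> 0 \<le> x i \<and> x i \<le> 1)"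
      using maps by (auto simp: cube_def)
    from kuhn_labelling_lemma'[OF this] that show ?thesis by blast
  qed
  \<comment> \<open>The guard \<open>i < p\<close> sits inside the existentials, so that choice
    later yields cube points \<open>R n i\<close> and \<open>S n i\<close> for all \<open>n\<close>
    and \<open>i\<close>.\<close>
  have approx: "\<exists>x. cube x \<and> (\<forall>i. \<exists>r s. cube r \<and> cube s \<and>
      (i < p \<longrightarrow> (\<forall>j<p. \<bar>r j - x j\<bar> \<le> 1 / real p \<and> \<bar>s j - x j\<bar> \<le> 1 / real p) \<and>
                r i \<le> f r i \<and> f s i \<le> s i))" if p: "0 < p" for p
  proof -
    obtain q where q: "\<forall>i<p. q i < p"
      and rs: "\<forall>i<p. \<exists>r s. (\<forall>j<p. q j \<le> r j \<and> r j \<le> q j + 1) \<and> (\<forall>j<p. q j \<le> s j \<and> s j \<le> q j + 1) \<and>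
                l (grid p r) i \<noteq> l (grid p s) i"
    proof (rule kuhn_lemma[of p p "\<lambda>v. l (grid p v)"])
      show "\<forall>x. (\<forall>i<p. x i \<le> p) \<longrightarrow> (\<forall>i<p. l (grid p x) i = 0 \<or> l (grid p x) i = 1)"
        using l(1) by (metis le_neq_implies_less less_one)
    next
      show "\<forall>x. (\<forall>i<p. x i \<le> p) \<longrightarrow> (\<forall>i<p. x i = 0 \<longrightarrow> l (grid p x) i = 0)"
        using l(2)[OF grid_cube] by (simp add: grid_def)
    next
      show "\<forall>x. (\<forall>i<p. x i \<le> p) \<longrightarrow> (\<forall>i<p. x i = p \<longrightarrow> l (grid p x) i = 1)"
        using l(3)[OF grid_cube] by (simp add: grid_def)
    qed (use p in auto)
    have close: "\<bar>grid p v j - grid p q j\<bar> \<le> 1 / real p"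
      if "j < p" "q j \<le> v j" "v j \<le> q j + 1" for v j
    proof -
      have "q j < p" using q that by simp
      then have "real (v j) / real p \<le> 1" "real (q j) / real p \<le> 1"
        using that p by auto
      then have "\<bar>grid p v j - grid p q j\<bar> = \<bar>(real (v j) - real (q j)) / real p\<bar>"
        using that by (simp add: grid_def diff_divide_distrib)
      also have "\<dots> \<le> 1 / real p"
        using that p by (simp add: abs_divide divide_right_mono)
      finally show ?thesis .
    qed
    have "\<exists>r s. cube r \<and> cube s \<and>
      (\<forall>j<p. \<bar>r j - grid p q j\<bar> \<le> 1 / real p \<and> \<bar>s j - grid p q j\<bar> \<le> 1 / real p) \<and>
                r i \<le> f r i \<and> f s i \<le> s i" if i: "i < p" for i
    proof -
      obtain r s where r: "\<forall>j<p. q j \<le> r j \<and> r j \<le> q j + 1"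
        and s: "\<forall>j<p. q j \<le> s j \<and> s j \<le> q j + 1"
        and ne: "l (grid p r) i \<noteq> l (grid p s) i"
        using rs i by blast
      \<comment> \<open>Kuhn's lemma only says that the two labels differ; with \<open>v\<close> and
        \<open>w\<close> arbitrary this covers both orders of the two vertices.\<close>
      have *: ?thesis if "\<forall>j<p. q j \<le> v j \<and> v j \<le> q j + 1" "\<forall>j<p. q j \<le> w j \<and> w j \<le> q j + 1"
        "l (grid p v) i = 0" "l (grid p w) i = 1" for v w
        using that close grid_cube l(4,5)[OF grid_cube]
        by (intro exI[of _ "grid p v"] exI[of _ "grid p w"]) auto
      have "l (grid p r) i = 0 \<and> l (grid p s) i = 1 \<or> l (grid p r) i = 1 \<and> l (grid p s) i = 0"
        using ne l(1)[of "grid p r" i] l(1)[of "grid p s" i] by linarith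
      then show ?thesis
        using *[OF r s] *[OF s r] by blast
    qed
    then show ?thesis
      using grid_cube by (intro exI[of _ "grid p q"]) metis
  qed
  have "\<forall>n. \<exists>x. cube x \<and> (\<forall>i. \<exists>r s. cube r \<and> cube s \<and>
      (i < Suc n \<longrightarrow> (\<forall>j<Suc n. \<bar>r j - x j\<bar> \<le> 1 / real (Suc n) \<and> \<bar>s j - x j\<bar> \<le> 1 / real (Suc n)) \<and>
                r i \<le> f r i \<and> f s i \<le> s i))"
    using approx by blast
  then obtain X where X: "\<And>n. cube (X n)"
    and "\<forall>n i. \<exists>r s. cube r \<and> cube s \<and>
      (i < Suc n \<longrightarrow> (\<forall>j<Suc n. \<bar>r j - X n j\<bar> \<le> 1 / real (Suc n) \<and> \<bar>s j - X n j\<bar> \<le> 1 / real (Suc n)) \<and>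
                r i \<le> f r i \<and> f s i \<le> s i)"
    by metis
  then obtain R S where RS: "\<And>n i. cube (R n i)" "\<And>n i. cube (S n i)"
      "\<And>n i j. i < Suc n \<Longrightarrow> j < Suc n \<Longrightarrow> \<bar>R n i j - X n j\<bar> \<le> 1 / real (Suc n)"
      "\<And>n i j. i < Suc n \<Longrightarrow> j < Suc n \<Longrightarrow> \<bar>S n i j - X n j\<bar> \<le> 1 / real (Suc n)"
      "\<And>n i. i < Suc n \<Longrightarrow> R n i i \<le> f (R n i) i"
      "\<And>n i. i < Suc n \<Longrightarrow> f (S n i) i \<le> S n i i"
    by metis
  have "norm (X n j) \<le> 1" for n j
    using X[of n] by (auto simp: cube_def)
  then obtain k where k: "strict_mono k" and "\<And>j. \<exists>y. (\<lambda>n. X (k n) j) \<longlonglongrightarrow> y"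
    using function_convergent_subsequence[of "UNIV :: nat set" X 1] by (metis UNIV_I uncountable_def countableI_type)
  then obtain x where x: "\<And>j. (\<lambda>n. X (k n) j) \<longlonglongrightarrow> x j"
    by metis
  have small: "(\<lambda>n. 1 / real (Suc (k n))) \<longlonglongrightarrow> 0"
    using LIMSEQ_subseq_LIMSEQ[OF LIMSEQ_inverse_real_of_nat k]
    by (simp add: o_def inverse_eq_divide)
  \<comment> \<open>The approximation at index \<open>n\<close> controls only the coordinates up to
    \<open>n\<close>; along \<open>k\<close> a given pair of coordinates is controlled
    eventually.\<close>
  have ev: "\<forall>\<^sub>F n in sequentially. i < Suc (k n) \<and> j < Suc (k n)" for i j
  proof (rule eventually_sequentiallyI[of "max i j"])
    fix n assume "max i j \<le> n"
    moreover have "n \<le> k n" using k by (rule strict_mono_imp_increasing)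
    ultimately show "i < Suc (k n) \<and> j < Suc (k n)" by simp
  qed
  have near: "(\<lambda>n. Y (k n) j) \<longlonglongrightarrow> x j"
    if "\<And>n. i < Suc n \<Longrightarrow> j < Suc n \<Longrightarrow> \<bar>Y n j - X n j\<bar> \<le> 1 / real (Suc n)" for Y :: "nat \<Rightarrow> nat \<Rightarrow> real" and i j
  proof -
    have "(\<lambda>n. Y (k n) j - X (k n) j) \<longlonglongrightarrow> 0"
      by (rule Lim_null_comparison[OF _ small]) (use ev[of i j] that in \<open>auto elim!: eventually_mono\<close>)
    from tendsto_add[OF this x[of j]] show ?thesis by simp
  qed
  have R: "(\<lambda>n. R (k n) i j) \<longlonglongrightarrow> x j" and S: "(\<lambda>n. S (k n) i j) \<longlonglongrightarrow> x j" for i j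
    using near[of i j "\<lambda>n. R n i"] near[of i j "\<lambda>n. S n i"] RS(3,4) by auto
  have "f x i = x i" for i
  proof (rule antisym)
    have "(\<lambda>n. f (R (k n) i) i) \<longlonglongrightarrow> f x i"
      using RS(1) R by (intro cont) (auto simp: cube_def)
    then show "x i \<le> f x i"
      using ev[of i i] RS(5) by (intro tendsto_le[OF _ _ R[of i i]]) (auto elim: eventually_mono)
    have "(\<lambda>n. f (S (k n) i) i) \<longlonglongrightarrow> f x i"
      using RS(2) S by (intro cont) (auto simp: cube_def)
    then show "f x i \<le> x i"
      using ev[of i i] RS(6) by (intro tendsto_le[OF _ S[of i i]]) (auto elim: eventually_mono)
  qed
  moreover have "x j \<in> {0..1}" for j
  proof -
    have "closed {0..1::real}" by simp
    from closed_sequentially[OF this _ x[of j]] X show ?thesis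
      by (auto simp: cube_def)
  qed
  ultimately show ?thesis
    using that by blast
qed

text \<open>The term \<open>max 0 (1 - sum (y a) (S a)) / card (S a)\<close> extends Nash's map from the simplex to the
  cube: it keeps the denominator at least 1 and vanishes at a fixed point.\<close>

lemma simplex_product_equilibrium:
  fixes S :: "'a \<Rightarrow> 'm set" and g :: "('a \<Rightarrow> 'm \<Rightarrow> real) \<Rightarrow> 'a \<Rightarrow> 'm \<Rightarrow> real"
  assumes Ag: "countable Ag" and S: "\<And>a. a \<in> Ag \<Longrightarrow> finite (S a)" "\<And>a. a \<in> Ag \<Longrightarrow> S a \<noteq> {}"
    and cont: "\<And>Y y a m. a \<in> Ag \<Longrightarrow> m \<in> S a \<Longrightarrow> (\<And>b k. (\<lambda>n. Y n b k) \<longlonglongrightarrow> y b k) \<Longrightarrow>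
                 (\<lambda>n. g (Y n) a m) \<longlonglongrightarrow> g y a m"
  obtains p where "\<And>a. a \<in> Ag \<Longrightarrow> is_dist (p a) (S a)"
    "\<And>a m. a \<in> Ag \<Longrightarrow> m \<in> S a \<Longrightarrow> g p a m \<le> (\<Sum>k\<in>S a. p a k * g p a k)"
proof -
  define C where "C = Sigma Ag S"
  have C: "countable C"
    unfolding C_def using Ag S(1) by (intro countable_SIGMA) (auto intro: countable_finite)
  \<comment> \<open>The cube coordinates number the pairs in \<open>C\<close>, and
    \<open>dec\<close> reads a point of the cube as a table of weights. Coordinates that number no
    pair are sent to 0 by \<open>f\<close>.\<close>
  define dec where "dec = (\<lambda>(x::nat \<Rightarrow> real) a m. if (a, m) \<in> C then x (to_nat_on C (a, m)) else 0)"
  define gain where "gain = (\<lambda>y a m. max 0 (g y a m - (\<Sum>k\<in>S a. y a k * g y a k)))"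
  define num where "num = (\<lambda>y a m. y a m + max 0 (1 - sum (y a) (S a)) / card (S a) + gain y a m)"
  define f where "f = (\<lambda>x n. if n \<in> to_nat_on C ` C
      then (case from_nat_into C n of (a, m) \<Rightarrow> num (dec x) a m / sum (num (dec x) a) (S a)) else 0)"
  \<comment> \<open>With \<open>t = sum (y a) (S a)\<close> this is the identity t + max 0 (1 - t) =
    max 1 t, the correction being spread evenly over \<open>S a\<close>.\<close>
  have num_sum: "sum (num y a) (S a) = max 1 (sum (y a) (S a)) + sum (gain y a) (S a)"
    if "a \<in> Ag" for y a
    using S[OF that] by (simp add: num_def sum.distrib)
  have gain_nonneg: "0 \<le> gain y a m" for y a m
    by (simp add: gain_def)
  have den_ge: "1 \<le> sum (num y a) (S a)" if "a \<in> Ag" for y a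
    using num_sum[OF that, of y] sum_nonneg[of "S a" "gain y a"] gain_nonneg[of y a] by auto
  have dec_range: "dec x a m \<in> {0..1}" if "\<And>j. x j \<in> {0..1}" for x a m
    using that by (simp add: dec_def)
  have num_nonneg: "0 \<le> num (dec x) a m" if "\<And>j. x j \<in> {0..1}" for x a m
    using dec_range[of x a m, OF that] gain_nonneg[of "dec x" a m] by (simp add: num_def)
  obtain x where x: "\<And>j. x j \<in> {0..1}" and fx: "f x = x"
  proof (rule Hilbert_cube_fixpoint[of f])
    fix x :: "nat \<Rightarrow> real" and i
    assume "\<forall>j. x j \<in> {0..1}"
    then have nn: "0 \<le> num (dec x) a m" for a m using num_nonneg by blast
    have "num (dec x) a m / sum (num (dec x) a) (S a) \<in> {0..1}" if "(a, m) \<in> C" for a m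
    proof -
      have "a \<in> Ag" "m \<in> S a" using that by (auto simp: C_def)
      then have "num (dec x) a m \<le> sum (num (dec x) a) (S a)"
        using nn S by (intro member_le_sum) auto
      then show ?thesis using nn[of a m] den_ge[OF \<open>a \<in> Ag\<close>, of "dec x"] by auto
    qed
    then show "f x i \<in> {0..1}"
      using C by (auto simp: f_def split: prod.splits)
  next
    fix X :: "nat \<Rightarrow> nat \<Rightarrow> real" and x i
    assume lim: "\<And>j. (\<lambda>n. X n j) \<longlonglongrightarrow> x j"
    \<comment> \<open>\<open>cont\<close> asks for convergence at every pair, also outside
      \<open>C\<close>; there the table is constantly 0.\<close>
    have dl: "(\<lambda>n. dec (X n) a m) \<longlonglongrightarrow> dec x a m" for a m
      using lim by (simp add: dec_def)
    have gl: "(\<lambda>n. gain (dec (X n)) a m) \<longlonglongrightarrow> gain (dec x) a m" if "a \<in> Ag" "m \<in> S a" for a m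
      unfolding gain_def using that
      by (intro tendsto_intros cont[OF _ _ dl] dl) auto
    have nl: "(\<lambda>n. num (dec (X n)) a m) \<longlonglongrightarrow> num (dec x) a m" if "a \<in> Ag" "m \<in> S a" for a m
      unfolding num_def using that S[OF that(1)]
      by (intro tendsto_intros gl dl) auto
    have ql: "(\<lambda>n. num (dec (X n)) a m / sum (num (dec (X n)) a) (S a))
             \<longlonglongrightarrow> num (dec x) a m / sum (num (dec x) a) (S a)" if "(a, m) \<in> C" for a m
      using that den_ge[of a "dec x"]
      by (intro tendsto_divide nl tendsto_sum) (auto simp: C_def)
    show "(\<lambda>n. f (X n) i) \<longlonglongrightarrow> f x i"
      using C ql by (auto simp: f_def split: prod.splits)
  qed blast
  define p where "p = dec x"
  have fp: "p a m = num p a m / sum (num p a) (S a)" if "a \<in> Ag" "m \<in> S a" for a m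
  proof -
    have "(a, m) \<in> C" using that by (simp add: C_def)
    then have "p a m = f x (to_nat_on C (a, m))"
      by (simp add: p_def dec_def fx)
    also have "\<dots> = num p a m / sum (num p a) (S a)"
      using \<open>(a, m) \<in> C\<close> C by (simp add: f_def p_def)
    finally show ?thesis .
  qed
  have sum1: "sum (p a) (S a) = 1" if "a \<in> Ag" for a
  proof -
    have "sum (p a) (S a) = (\<Sum>m\<in>S a. num p a m / sum (num p a) (S a))"
      using fp that by (intro sum.cong) auto
    also have "\<dots> = 1"
      using den_ge[OF that, of p] by (simp flip: sum_divide_distrib)
    finally show ?thesis .
  qed
  have p_range: "p a m \<in> {0..1}" for a m
    unfolding p_def using x by (rule dec_range)
  show ?thesis
  proof
    fix a assume a: "a \<in> Ag"
    have "p a m = 0" if "m \<notin> S a" for m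
      using that by (simp add: p_def dec_def C_def)
    then show "is_dist (p a) (S a)"
      using p_range[of a] sum1[OF a] by (simp add: is_dist_def)
  next
    fix a m assume a: "a \<in> Ag" and m: "m \<in> S a"
    define avg where "avg = (\<Sum>k\<in>S a. p a k * g p a k)"
    define G where "G = sum (gain p a) (S a)"
    have G0: "0 \<le> G" unfolding G_def using gain_nonneg by (intro sum_nonneg)
    \<comment> \<open>The fixed point equation cleared of its denominator \<open>1 + G\<close>; the
      correction term is gone because the weights sum to 1.\<close>
    have eq: "p a k * G = gain p a k" if "k \<in> S a" for k
    proof -
      have "p a k = (p a k + gain p a k) / (1 + G)"
        using fp[OF a that] num_sum[OF a, of p] sum1[OF a] by (simp add: num_def G_def)
      then show ?thesis using G0 by (simp add: field_simps)
    qed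
    \<comment> \<open>If \<open>G\<close> were positive, every move of positive weight would have
      positive gain, hence a value above \<open>avg\<close>; but \<open>avg\<close> is the average
      of exactly these values.\<close>
    have "G = 0"
    proof (rule ccontr)
      assume "G \<noteq> 0"
      then have G: "0 < G" using G0 by simp
      have pos: "avg < g p a k" if "k \<in> S a" "0 < p a k" for k
      proof -
        have "0 < gain p a k" using eq[OF that(1)] that(2) G by (metis mult_pos_pos)
        then show ?thesis by (simp add: gain_def avg_def)
      qed
      have "avg = (\<Sum>k\<in>S a. p a k * avg)"
        using sum1[OF a] by (simp flip: sum_distrib_right)
      also have "\<dots> < (\<Sum>k\<in>S a. p a k * g p a k)"
      proof (rule sum_strict_mono_ex1)
        show "\<forall>k\<in>S a. p a k * avg \<le> p a k * g p a k"
          using pos p_range[of a] by (metis atLeastAtMost_iff less_eq_real_def mult_eq_0_iff mult_less_cancel_left_pos order.refl)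
        have "\<exists>k\<in>S a. 0 < p a k"
        proof (rule ccontr)
          assume "\<not> ?thesis"
          then have "sum (p a) (S a) \<le> 0" by (intro sum_nonpos) auto
          then show False using sum1[OF a] by simp
        qed
        then show "\<exists>k\<in>S a. p a k * avg < p a k * g p a k"
          using pos by (meson mult_strict_left_mono)
      qed (use S a in auto)
      finally show False by (simp add: avg_def)
    qed
    then have "gain p a m = 0" using eq[OF m] by simp
    then show "g p a m \<le> (\<Sum>k\<in>S a. p a k * g p a k)"
      by (simp add: gain_def max_def split: if_splits)
  qed
qed

subsection \<open>Histories and perfect recall\<close>

text \<open>Summand \<open>k\<close> is the difference of two consecutive hybrid products, which
  take their factors from \<open>x\<close> up to a position and from \<open>y\<close> after it. In
  the application \<open>x\<close> belongs to the deviation and \<open>y\<close> to the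
  equilibrium.\<close>

lemma prod_diff_telescope:
  fixes x y :: "nat \<Rightarrow> 'a::comm_ring_1"
  shows "(\<Prod>k<n. x k) - (\<Prod>k<n. y k) =
         (\<Sum>k<n. (\<Prod>j<k. x j) * (x k - y k) * (\<Prod>j\<in>{Suc k..<n}. y j))"
proof (induction n)
  case (Suc n)
  have "(\<Sum>k<n. (\<Prod>j<k. x j) * (x k - y k) * (\<Prod>j\<in>{Suc k..<Suc n}. y j)) =
        (\<Sum>k<n. (\<Prod>j<k. x j) * (x k - y k) * (\<Prod>j\<in>{Suc k..<n}. y j)) * y n"
    unfolding sum_distrib_right by (intro sum.cong) (auto simp: mult.assoc)
  also have "\<dots> = ((\<Prod>k<n. x k) - (\<Prod>k<n. y k)) * y n"
    using Suc.IH by simp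
  finally show ?case
    by (simp add: algebra_simps)
qed simp

lemma extensive_game_H: "extensive_game G \<Longrightarrow> finite (H G) \<and> prefix_closed (H G)"
  unfolding extensive_game_def by (elim conjE) (intro conjI)

lemma extensive_game_Info:
  assumes "extensive_game G"
  shows "\<Union> (Info G i) = Hi G i" "{} \<notin> Info G i"
    "\<forall>I \<in> Info G i. \<forall>J \<in> Info G i. I \<noteq> J \<longrightarrow> I \<inter> J = {}"
    "\<forall>I \<in> Info G i. \<forall>h \<in> I. \<forall>h' \<in> I. moves G h = moves G h'"
proof -
  have "\<forall>i. \<Union> (Info G i) = Hi G i \<and> {} \<notin> Info G i \<and>
          (\<forall>I \<in> Info G i. \<forall>J \<in> Info G i. I \<noteq> J \<longrightarrow> I \<inter> J = {}) \<and>
          (\<forall>I \<in> Info G i. \<forall>h \<in> I. \<forall>h' \<in> I. moves G h = moves G h')"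
    using assms unfolding extensive_game_def by (elim conjE)
  note * = spec[OF this, of i]
  from * show "\<Union> (Info G i) = Hi G i" by (elim conjE)
  from * show "{} \<notin> Info G i" by (elim conjE)
  from * show "\<forall>I \<in> Info G i. \<forall>J \<in> Info G i. I \<noteq> J \<longrightarrow> I \<inter> J = {}" by (elim conjE)
  from * show "\<forall>I \<in> Info G i. \<forall>h \<in> I. \<forall>h' \<in> I. moves G h = moves G h'" by (elim conjE)
qed

lemma take_in_nonterminal:
  assumes "extensive_game G" "z \<in> H G" "k < length z"
  shows "take k z \<in> H G - Z G" "z ! k \<in> moves G (take k z)"
proof -
  have pc: "\<And>h. prefix h z \<Longrightarrow> h \<in> H G"
    using assms(2) extensive_game_H[OF assms(1)] by (auto simp: prefix_closed_def)
  have "strict_prefix (take k z) z"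
    using assms(3) by (auto simp: strict_prefix_def take_is_prefix)
  then show "take k z \<in> H G - Z G"
    using pc[OF take_is_prefix] assms(2) by (auto simp: Z_def)
  show "z ! k \<in> moves G (take k z)"
    using pc[OF take_is_prefix, of "Suc k"] assms(3) by (simp add: moves_def take_Suc_conv_app_nth)
qed

lemma finite_moves:
  assumes "extensive_game G"
  shows "finite (moves G h)"
proof (rule finite_subset)
  show "moves G h \<subseteq> last ` H G"
    by (force simp: moves_def intro: image_eqI[where x = "h @ [_]"])
  show "finite (last ` H G)"
    using extensive_game_H[OF assms] by simp
qed

lemma moves_nonempty:
  assumes "extensive_game G" "h \<in> H G - Z G"
  shows "moves G h \<noteq> {}"
proof -
  obtain h' where h': "h' \<in> H G" "strict_prefix h h'"
    using assms(2) by (auto simp: Z_def)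
  then have "length h < length h'" "take (length h) h' = h"
    by (auto simp: prefix_length_less strict_prefix_def prefix_def)
  then show ?thesis
    using take_in_nonterminal(2)[OF assms(1) h'(1), of "length h"] by auto
qed

lemma Info_subset_Hi: "extensive_game G \<Longrightarrow> I \<in> Info G i \<Longrightarrow> I \<subseteq> Hi G i"
  using extensive_game_Info(1)[of G i] by blast

lemma Info_nonempty: "extensive_game G \<Longrightarrow> I \<in> Info G i \<Longrightarrow> I \<noteq> {}"
  using extensive_game_Info(2)[of G i] by blast

lemma Info_moves_eq:
  "extensive_game G \<Longrightarrow> I \<in> Info G i \<Longrightarrow> h \<in> I \<Longrightarrow> h' \<in> I \<Longrightarrow> moves G h = moves G h'"
  using extensive_game_Info(4)[of G i] by blast

lemma Info_disjoint:
  "extensive_game G \<Longrightarrow> I \<in> Info G i \<Longrightarrow> J \<in> Info G i \<Longrightarrow> h \<in> I \<Longrightarrow> h \<in> J \<Longrightarrow> I = J"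
  using extensive_game_Info(3)[of G i] by blast

lemma finite_Info: "extensive_game G \<Longrightarrow> finite (Info G i)"
proof -
  assume G: "extensive_game G"
  then have "Info G i \<subseteq> Pow (H G)"
    using Info_subset_Hi[of G _ i] by (auto simp: Hi_def)
  then show ?thesis
    using extensive_game_H[OF G] by (meson finite_Pow_iff finite_subset)
qed

lemma same_info_of_refl: "extensive_game G \<Longrightarrow> h \<in> Hi G i \<Longrightarrow> same_info_of G i h h"
  using extensive_game_Info(1)[of G i] unfolding same_info_of_def by blast

lemma same_info_of_sym: "same_info_of G i h h' \<Longrightarrow> same_info_of G i h' h"
  unfolding same_info_of_def by blast

lemma same_info_of_trans:
  "extensive_game G \<Longrightarrow> same_info_of G i x y \<Longrightarrow> same_info_of G i y z \<Longrightarrow> same_info_of G i x z"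
  unfolding same_info_of_def using Info_disjoint[of G _ i _ y] by metis

lemma same_info_of_Hi: "extensive_game G \<Longrightarrow> same_info_of G i x y \<Longrightarrow> x \<in> Hi G i \<and> y \<in> Hi G i"
  unfolding same_info_of_def using Info_subset_Hi[of G _ i] by (meson subsetD)

text \<open>Infinite descent on length. If \<open>x\<close> strictly precedes \<open>y\<close>,
  perfect recall applied to \<open>y\<close>, \<open>x\<close> and the prefix \<open>x\<close> of
  \<open>y\<close> gives a \<open>w\<close> in the same information set such that the move played
  after \<open>x\<close> is also played after \<open>w\<close> within \<open>x\<close>; so
  \<open>w\<close> strictly precedes \<open>x\<close>.\<close>

lemma no_absent_mindedness:
  assumes G: "extensive_game G" and pr: "perfect_recall G"
  shows "same_info_of G i x y \<Longrightarrow> \<not> strict_prefix x y"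
proof (induction "length x" arbitrary: x y rule: less_induct)
  case less
  show ?case
  proof
    assume sp: "strict_prefix x y"
    then have "prefix x y" "length x < length y"
      by (auto simp: prefix_length_less)
    then have ext: "prefix (x @ [y ! length x]) y"
      by (metis append_one_prefix)
    have "P G x = Player i"
      using same_info_of_Hi[OF G less.prems] by (simp add: Hi_def)
    moreover obtain I where "I \<in> Info G i" "x \<in> I" "y \<in> I"
      using less.prems by (auto simp: same_info_of_def)
    ultimately obtain w where w: "prefix w x" "same_info_of G i x w"
      "\<forall>m. prefix (x @ [m]) y \<longrightarrow> prefix (w @ [m]) x"
      using pr \<open>prefix x y\<close> unfolding perfect_recall_def by blast
    then have "strict_prefix w x"
      using ext by (metis prefix_snocD)
    then show False
      using less.hyps[of w x] w(2) same_info_of_sym by (metis prefix_length_less)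
  qed
qed

text \<open>The product over the decision nodes passed by a history is reindexed by the pairs
  (information set, chosen move); perfect recall makes this set of pairs the same for all
  members of an information set, and each information set is met at most once.\<close>

lemma own_weight_eq:
  fixes w :: "'m list \<Rightarrow> 'm \<Rightarrow> real"
  assumes G: "extensive_game G" and pr: "perfect_recall G"
    and hh: "same_info_of G i h h'"
    and resp: "\<And>x y. same_info_of G i x y \<Longrightarrow> c x = c y"
      "\<And>x y. same_info_of G i x y \<Longrightarrow> c x \<Longrightarrow> w x = w y"
  shows "(\<Prod>j<length h. if c (take j h) \<and> P G (take j h) = Player i then w (take j h) (h ! j) else 1) =
         (\<Prod>j<length h'. if c (take j h') \<and> P G (take j h') = Player i then w (take j h') (h' ! j) else 1)"
proof -
  define own_at where "own_at = (\<lambda>x. {j. j < length x \<and> c (take j x) \<and> P G (take j x) = Player i})"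
  define cell where "cell = (\<lambda>x. Collect (same_info_of G i x))"
  define lab where "lab = (\<lambda>x j. (cell (take j x), x ! j))"
  \<comment> \<open>The choice of a member is harmless: on an information set where \<open>c\<close>
    holds, \<open>w\<close> is constant.\<close>
  define W where "W = (\<lambda>(I, m). w (SOME x. x \<in> I) m)"
  have cell_eq: "cell x = cell y \<longleftrightarrow> same_info_of G i x y" if "x \<in> Hi G i" "y \<in> Hi G i" for x y
  proof
    assume "cell x = cell y"
    then show "same_info_of G i x y"
      using same_info_of_refl[OF G that(2)] by (auto simp: cell_def set_eq_iff)
  next
    assume "same_info_of G i x y"
    then show "cell x = cell y"
      unfolding cell_def
      by (intro Collect_cong) (metis same_info_of_trans[OF G] same_info_of_sym)
  qed
  have Hi: "take j x \<in> Hi G i" if "x \<in> Hi G i" "j \<in> own_at x" for x j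
    using that take_in_nonterminal[OF G, of x j] by (auto simp: Hi_def own_at_def)
  have prod_lab: "(\<Prod>j<length x. if c (take j x) \<and> P G (take j x) = Player i then w (take j x) (x ! j) else 1) =
       prod W (lab x ` own_at x)" if x: "x \<in> Hi G i" for x
  proof -
    \<comment> \<open>Two positions with the same label would be nested histories in one information
      set.\<close>
    have "inj_on (lab x) (own_at x)"
    proof (rule inj_onI, rule ccontr)
      fix j k assume jk: "j \<in> own_at x" "k \<in> own_at x" "lab x j = lab x k" "j \<noteq> k"
      have si: "same_info_of G i (take j x) (take k x)"
        using jk cell_eq[OF Hi[OF x jk(1)] Hi[OF x jk(2)]] by (simp add: lab_def)
      have "strict_prefix (take a x) (take b x)" if "a < b" "b < length x" for a b
      proof -
        have "take a x = take a (take b x)" using that by simp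
        then have "prefix (take a x) (take b x)" by (metis take_is_prefix)
        moreover have "length (take a x) \<noteq> length (take b x)" using that by simp
        ultimately show ?thesis by (metis strict_prefixI)
      qed
      then show False
        using jk no_absent_mindedness[OF G pr] si same_info_of_sym[OF si]
        by (metis (no_types, lifting) linorder_neqE_nat mem_Collect_eq own_at_def)
    qed
    then have "prod W (lab x ` own_at x) = (\<Prod>j\<in>own_at x. W (lab x j))"
      by (simp add: prod.reindex)
    also have "\<dots> = (\<Prod>j\<in>own_at x. w (take j x) (x ! j))"
    proof (rule prod.cong)
      fix j assume j: "j \<in> own_at x"
      have "take j x \<in> cell (take j x)"
        using same_info_of_refl[OF G Hi[OF x j]] by (simp add: cell_def)
      then have "(SOME y. y \<in> cell (take j x)) \<in> cell (take j x)"
        by (rule someI)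
      then have "same_info_of G i (take j x) (SOME y. y \<in> cell (take j x))"
        by (simp add: cell_def)
      then have "w (take j x) = w (SOME y. y \<in> cell (take j x))"
        using j by (intro resp(2)) (auto simp: own_at_def)
      then show "W (lab x j) = w (take j x) (x ! j)"
        by (simp add: W_def lab_def)
    qed simp
    also have "\<dots> = (\<Prod>j<length x. if c (take j x) \<and> P G (take j x) = Player i then w (take j x) (x ! j) else 1)"
      by (rule prod.mono_neutral_cong_left) (auto simp: own_at_def)
    finally show ?thesis ..
  qed
  have sub: "lab x ` own_at x \<subseteq> lab y ` own_at y" if xy: "same_info_of G i x y" for x y
  proof
    fix t assume "t \<in> lab x ` own_at x"
    then obtain j where j: "j \<in> own_at x" and t: "t = lab x j" by blast
    obtain I where "I \<in> Info G i" "x \<in> I" "y \<in> I"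
      using xy by (auto simp: same_info_of_def)
    moreover have "prefix (take j x) x \<and> P G (take j x) = Player i"
      using j by (simp add: own_at_def take_is_prefix)
    ultimately obtain v where v: "prefix v y" "same_info_of G i (take j x) v"
      "\<forall>m. prefix (take j x @ [m]) x \<longrightarrow> prefix (v @ [m]) y"
      using pr unfolding perfect_recall_def by blast
    \<comment> \<open>Perfect recall puts \<open>v\<close> followed by the same move on
      \<open>y\<close>, so the label recurs there at position \<open>length v\<close>.\<close>
    have "take j x @ [x ! j] = take (Suc j) x"
      using j by (simp add: own_at_def take_Suc_conv_app_nth)
    then have "prefix (v @ [x ! j]) y"
      using v(3) by (metis take_is_prefix)
    then obtain ys where ys: "y = v @ x ! j # ys"
      by (auto simp: prefix_def)
    have vH: "v \<in> Hi G i" using same_info_of_Hi[OF G v(2)] by simp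
    have "c v" using resp(1)[OF v(2)] j by (simp add: own_at_def)
    then have "length v \<in> own_at y"
      using vH ys by (auto simp: own_at_def Hi_def)
    moreover have "lab y (length v) = t"
      using cell_eq[OF vH] same_info_of_Hi[OF G v(2)] same_info_of_sym[OF v(2)] ys
      by (simp add: t lab_def)
    ultimately show "t \<in> lab y ` own_at y" by blast
  qed
  show ?thesis
    using sub[OF hh] sub[OF same_info_of_sym[OF hh]] same_info_of_Hi[OF G hh]
    by (simp add: prod_lab subset_antisym)
qed

subsection \<open>Counterfactual values\<close>

text \<open>Collects the typing of \<open>F\<close> and the conditions C4 and C7. By C4,
  \<open>F\<close> takes the same value at all members of the target information set; by C7, a game
  mapped to itself has the node's own information set as target.\<close>

lemma game_aou_F:
  assumes "game_aou G GG Gm F" "Gp \<in> GG" "h \<in> Hi Gp i"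
  shows "fst (F Gp h) \<in> GG" "snd (F Gp h) \<in> Info (fst (F Gp h)) i"
    "\<And>h'. h' \<in> snd (F Gp h) \<Longrightarrow> F (fst (F Gp h)) h' = F Gp h"
    "\<And>h'. fst (F Gp h) = Gp \<Longrightarrow> h' \<in> snd (F Gp h) \<longleftrightarrow> same_info_of Gp i h h'"
proof -
  note tail = assms(1)[unfolded game_aou_def Let_def, THEN conjunct2, THEN conjunct2, THEN conjunct2,
      THEN conjunct2, THEN conjunct2, THEN conjunct2, THEN conjunct2, THEN conjunct2]
  note F = bspec[OF spec[OF bspec[OF conjunct1[OF tail] assms(2)], of i] assms(3)]
  note C3 = bspec[OF spec[OF bspec[OF conjunct2[OF tail] assms(2)], of i] assms(3),
      THEN conjunct2, THEN conjunct2]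
  note C4 = conjunct1[OF conjunct2[OF C3]]
  note C7 = C3[THEN conjunct2, THEN conjunct2, THEN conjunct2, THEN conjunct2, THEN conjunct1]
  show "fst (F Gp h) \<in> GG" "snd (F Gp h) \<in> Info (fst (F Gp h)) i"
    using F by auto
  show "F (fst (F Gp h)) h' = F Gp h" if "h' \<in> snd (F Gp h)" for h'
    using bspec[OF C4 that] by simp
  show "h' \<in> snd (F Gp h) \<longleftrightarrow> same_info_of Gp i h h'" if "fst (F Gp h) = Gp" for h'
    using C7 that by blast
qed

lemma game_aou_games:
  assumes "game_aou G GG Gm F"
  shows "countable GG" "\<And>Gp. Gp \<in> GG \<Longrightarrow> extensive_game Gp" "\<And>Gp. Gp \<in> GG \<Longrightarrow> perfect_recall Gp"
proof -
  note GG = conjunct1[OF conjunct2[OF assms[unfolded game_aou_def]]]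
  show "countable GG"
    by (rule conjunct1[OF assms[unfolded game_aou_def]])
  fix Gp assume "Gp \<in> GG"
  from bspec[OF GG this] have "augmented G Gp" .
  then show "extensive_game Gp"
    unfolding augmented_def by (elim conjE)
  from \<open>augmented G Gp\<close> show "perfect_recall Gp"
    unfolding augmented_def by (elim conjE)
qed

text \<open>An agent is a triple of a player, a game and an information set of that player in the
  game; since \<open>F Gp h\<close> is a pair of a game and an information set, the agent moving
  at \<open>h\<close> in \<open>Gp\<close> is \<open>(i, F Gp h)\<close>.\<close>

type_synonym ('n, 'm) behaviour = "'n \<times> ('n, 'm) aug \<times> 'm list set \<Rightarrow> 'm \<Rightarrow> real"

text \<open>The slot \<open>G'\<close> need not be consulted, since \<open>F Gp h\<close> already
  names the game. Reading the behaviour through \<open>F\<close> makes the strategy constant on the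
  classes of nodes with equal \<open>F\<close>.\<close>

definition profile_of :: "('n, 'm) Fmap \<Rightarrow> ('n, 'm) behaviour \<Rightarrow> ('n, 'm) profile" where
  "profile_of F p i G' Gp h = p (i, F Gp h)"

text \<open>These are the nodes of \<open>G'\<close> governed by the local strategy of the pair
  \<open>(i, G')\<close>: player \<open>i\<close> moves there and takes the game to be
  \<open>G'\<close> itself.\<close>

definition own :: "('n, 'm) Fmap \<Rightarrow> 'n \<Rightarrow> ('n, 'm) aug \<Rightarrow> 'm list \<Rightarrow> bool" where
  "own F i G' h \<longleftrightarrow> fst (F G' h) = G' \<and> P G' h = Player i"

abbreviation move_prob :: "('n, 'm) Fmap \<Rightarrow> ('n, 'm) behaviour \<Rightarrow> ('n, 'm) aug \<Rightarrow> 'm list \<Rightarrow> 'm \<Rightarrow> real" where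
  "move_prob F p \<equiv> step_prob F (profile_of F p)"

text \<open>Own moves before position \<open>k\<close> count as 1 and the move at \<open>k\<close>
  is left out, while later moves, own ones included, keep their probability under \<open>p\<close>.
  This is what a summand of the telescoping sum leaves once the deviation's own factors and the
  difference at \<open>k\<close> are taken out.\<close>

definition cf_weight ::
  "('n, 'm) Fmap \<Rightarrow> ('n, 'm) behaviour \<Rightarrow> 'n \<Rightarrow> ('n, 'm) aug \<Rightarrow> 'm list \<Rightarrow> nat \<Rightarrow> real" where
  "cf_weight F p i G' z k =
     (\<Prod>j<k. if own F i G' (take j z) then 1 else move_prob F p G' (take j z) (z ! j)) *
     (\<Prod>j\<in>{Suc k..<length z}. move_prob F p G' (take j z) (z ! j)) * u G' i z"

text \<open>Not divided by the probability of reaching \<open>I\<close>: the value is thus defined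
  also at unreached information sets, and being built from \<open>p\<close> by sums and products
  alone it is continuous.\<close>

definition cf_value ::
  "('n, 'm) Fmap \<Rightarrow> ('n, 'm) behaviour \<Rightarrow> 'n \<times> ('n, 'm) aug \<times> 'm list set \<Rightarrow> 'm \<Rightarrow> real" where
  "cf_value F p = (\<lambda>(i, G', I) m.
     \<Sum>z\<in>Z G'. \<Sum>k<length z. if take k z \<in> I \<and> z ! k = m then cf_weight F p i G' z k else 0)"

lemma move_prob_tendsto:
  assumes "\<And>b m. (\<lambda>n. Y n b m) \<longlonglongrightarrow> y b m"
  shows "(\<lambda>n. move_prob F (Y n) G' h m) \<longlonglongrightarrow> move_prob F y G' h m"
  using assms by (auto simp: step_prob_def profile_of_def split: agent.split)

lemma cf_value_tendsto:
  assumes "\<And>b m. (\<lambda>n. Y n b m) \<longlonglongrightarrow> y b m"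
  shows "(\<lambda>n. cf_value F (Y n) a m) \<longlonglongrightarrow> cf_value F y a m"
proof -
  have "(\<lambda>n. if c then 1 else move_prob F (Y n) G' h m) \<longlonglongrightarrow> (if c then 1 else move_prob F y G' h m)"
    for c G' h m
    using move_prob_tendsto[of Y y, OF assms] by simp
  then have "(\<lambda>n. cf_weight F (Y n) i G' z k) \<longlonglongrightarrow> cf_weight F y i G' z k" for i G' z k
    unfolding cf_weight_def
    by (intro tendsto_mult tendsto_prod tendsto_const move_prob_tendsto[of Y y, OF assms])
  then have "(\<lambda>n. if c then cf_weight F (Y n) i G' z k else 0) \<longlonglongrightarrow>
             (if c then cf_weight F y i G' z k else 0)" for c i G' z k
    by simp
  then show ?thesis
    unfolding cf_value_def by (auto split: prod.split intro!: tendsto_sum)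
qed

section \<open>The effect of a deviation, summed over information sets\<close>

lemma sum_swap_dependent:
  fixes f :: "'a \<Rightarrow> 'b \<Rightarrow> 'c \<Rightarrow> 'd \<Rightarrow> 'e::comm_monoid_add"
  shows "(\<Sum>z\<in>X. \<Sum>k\<in>Y z. \<Sum>i\<in>V. \<Sum>m\<in>W i. f z k i m) =
         (\<Sum>i\<in>V. \<Sum>m\<in>W i. \<Sum>z\<in>X. \<Sum>k\<in>Y z. f z k i m)"
proof -
  have "(\<Sum>z\<in>X. \<Sum>k\<in>Y z. \<Sum>i\<in>V. \<Sum>m\<in>W i. f z k i m) =
        (\<Sum>z\<in>X. \<Sum>i\<in>V. \<Sum>k\<in>Y z. \<Sum>m\<in>W i. f z k i m)"
    by (intro sum.cong refl sum.swap)
  also have "\<dots> = (\<Sum>i\<in>V. \<Sum>z\<in>X. \<Sum>k\<in>Y z. \<Sum>m\<in>W i. f z k i m)"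
    by (rule sum.swap)
  also have "\<dots> = (\<Sum>i\<in>V. \<Sum>z\<in>X. \<Sum>m\<in>W i. \<Sum>k\<in>Y z. f z k i m)"
    by (intro sum.cong refl sum.swap)
  also have "\<dots> = (\<Sum>i\<in>V. \<Sum>m\<in>W i. \<Sum>z\<in>X. \<Sum>k\<in>Y z. f z k i m)"
    by (intro sum.cong refl sum.swap)
  finally show ?thesis .
qed

text \<open>The union serves as the move set of an information set without choosing a
  member.\<close>

lemma UN_moves_Info:
  assumes "extensive_game G" "I \<in> Info G i" "h \<in> I"
  shows "\<Union> (moves G ` I) = moves G h"
  using Info_moves_eq[OF assms(1,2) _ assms(3)] assms(3) by blast

text \<open>\<open>opt\<close> compares single moves at single information sets; this passes to
  deviations that act at all information sets of the pair at once.\<close>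

lemma no_profitable_deviation:
  fixes F :: "('n, 'm) Fmap"
  assumes game: "game_aou G GG Gm F" and G': "G' \<in> GG" and s: "local_strategy GG F i G' s"
    and opt: "\<And>I m. I \<in> Info G' i \<Longrightarrow> m \<in> \<Union> (moves G' ` I) \<Longrightarrow> cf_value F p (i, G', I) m
      \<le> (\<Sum>k\<in>\<Union> (moves G' ` I). p (i, G', I) k * cf_value F p (i, G', I) k)"
  shows "EU F ((profile_of F p)(i := (profile_of F p i)(G' := s))) i G' \<le> EU F (profile_of F p) i G'"
proof -
  define \<sigma>' where "\<sigma>' = (profile_of F p)(i := (profile_of F p i)(G' := s))"
  define ow where "ow = own F i G'"
  define mv where "mv = (\<lambda>I. \<Union> (moves G' ` I))"
  define b where "b = move_prob F p G'"
  define b' where "b' = step_prob F \<sigma>' G'"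
  define own_weight where
    "own_weight = (\<lambda>h. \<Prod>j<length h. if ow (take j h) then s G' (take j h) (h ! j) else 1)"
  \<comment> \<open>The information sets whose nodes are own nodes of the pair; at these the local
    strategy influences the runs of \<open>G'\<close>.\<close>
  define cells where "cells = (\<lambda>h. snd (F G' h)) ` {h \<in> Hi G' i. fst (F G' h) = G'}"
  define q where "q = (\<lambda>I. s G' (SOME h. h \<in> I))"
  define W where "W = (\<lambda>I. own_weight (SOME h. h \<in> I))"
  have eg: "extensive_game G'" and pr: "perfect_recall G'"
    using game_aou_games[OF game] G' by auto
  \<comment> \<open>The updated slot \<open>(i, G')\<close> is consulted at exactly those nodes
    where \<open>i\<close> moves and \<open>F\<close> leads back to \<open>G'\<close>.\<close>
  have b'_eq: "b' h m = (if ow h then s G' h m else b h m)" for h m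
    by (auto simp: b'_def b_def ow_def own_def step_prob_def \<sigma>'_def split: agent.split)
  have b_own: "b h m = p (i, F G' h) m" if "ow h" for h m
    using that by (simp add: b_def ow_def own_def step_prob_def profile_of_def)
  \<comment> \<open>C7 puts \<open>y\<close> into the set \<open>snd (F G' x)\<close>, and C4 then
    gives the equality.\<close>
  have F_eq: "F G' y = F G' x" if "same_info_of G' i x y" "fst (F G' x) = G'" for x y
    using game_aou_F(3,4)[OF game G', of x i y] same_info_of_Hi[OF eg that(1)] that by auto
  have ow_Hi: "ow h \<longleftrightarrow> h \<in> Hi G' i \<and> fst (F G' h) = G'" if "h \<in> H G' - Z G'" for h
    using that by (auto simp: ow_def own_def Hi_def)
  have cells_Info: "I \<in> Info G' i" if "I \<in> cells" for I
    using that game_aou_F(2)[OF game G'] by (auto simp: cells_def) metis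
  have cell_own: "h \<in> Hi G' i \<and> F G' h = (G', I) \<and> ow h" if I: "I \<in> cells" "h \<in> I" for I h
  proof -
    obtain x where x: "x \<in> Hi G' i" "fst (F G' x) = G'" "I = snd (F G' x)"
      using I(1) unfolding cells_def by blast
    have "h \<in> Hi G' i" using Info_subset_Hi[OF eg cells_Info[OF I(1)]] I(2) by blast
    moreover have "F G' h = F G' x"
      using game_aou_F(3)[OF game G' x(1)] x I(2) by simp
    ultimately show ?thesis
      using x by (auto simp: ow_def own_def Hi_def prod_eq_iff)
  qed
  have own_cell: "snd (F G' h) \<in> cells \<and> h \<in> snd (F G' h)" if "h \<in> Hi G' i" "fst (F G' h) = G'" for h
    using game_aou_F(4)[OF game G' that] same_info_of_refl[OF eg that(1)] that by (auto simp: cells_def)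
  have some_in: "(SOME h. h \<in> I) \<in> I" if "I \<in> cells" for I
    using Info_nonempty[OF eg cells_Info[OF that]] by (simp add: some_in_eq)
  have s_eq: "s G' x = s G' y" if "same_info_of G' i x y" "fst (F G' x) = G'" for x y
  proof -
    have "F G' x = F G' y" using F_eq[OF that] by simp
    then show ?thesis
      using s G' that(2) same_info_of_Hi[OF eg that(1)] unfolding local_strategy_def by blast
  qed
  have cell_si: "same_info_of G' i (SOME h. h \<in> I) h" if "I \<in> cells" "h \<in> I" for I h
    using that some_in[OF that(1)] cells_Info[OF that(1)] by (auto simp: same_info_of_def)
  have q_eq: "s G' h = q I" if "I \<in> cells" "h \<in> I" for I h
    unfolding q_def
    using s_eq[OF cell_si[OF that]] cell_own[OF that(1) some_in[OF that(1)]] by simp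
  have s_dist: "is_dist (s G' h) (moves G' h)" if "h \<in> Hi G' i" "fst (F G' h) = G'" for h
    using s that G' own_cell[OF that] unfolding local_strategy_def by blast
  have q_dist: "is_dist (q I) (mv I)" if I: "I \<in> cells" for I
  proof -
    have "is_dist (q I) (moves G' (SOME h. h \<in> I))"
      unfolding q_def using s_dist cell_own[OF I some_in[OF I]] by simp
    then show ?thesis
      by (simp add: mv_def UN_moves_Info[OF eg cells_Info[OF I] some_in[OF I]])
  qed
  \<comment> \<open>An instance of \<open>own_weight_eq\<close>: the condition
    \<open>fst (F G' x) = G'\<close> and the factors \<open>s G'\<close> depend only on the
    information set, by \<open>F_eq\<close> and \<open>s_eq\<close>.\<close>
  have own_weight_W: "own_weight h = W I" if "I \<in> cells" "h \<in> I" for I h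
  proof -
    have c: "(fst (F G' x) = G') = (fst (F G' y) = G')" if "same_info_of G' i x y" for x y
      using F_eq[OF that] F_eq[OF same_info_of_sym[OF that]] by metis
    have "own_weight (SOME h. h \<in> I) = own_weight h"
      unfolding own_weight_def ow_def own_def
      by (rule own_weight_eq[OF eg pr cell_si[OF that] c s_eq]) auto
    then show ?thesis by (simp add: W_def)
  qed
  have W_nonneg: "0 \<le> W I" if I: "I \<in> cells" for I
  proof -
    define h where "h = (SOME h. h \<in> I)"
    have h: "h \<in> H G'" using cell_own[OF I some_in[OF I]] by (auto simp: h_def Hi_def)
    have "0 \<le> s G' (take j h) (h ! j)" if "j < length h" "ow (take j h)" for j
      using s_dist[of "take j h"] ow_Hi[OF take_in_nonterminal(1)[OF eg h that(1)]] that(2)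
      by (auto simp: is_dist_def)
    then show ?thesis
      unfolding W_def own_weight_def h_def[symmetric] by (intro prod_nonneg) auto
  qed
  \<comment> \<open>At a node that is not own the difference in the middle is 0 and no cell contains
    the node; at an own node exactly one pair of a cell and a move contributes.\<close>
  have term_eq: "(\<Prod>j<k. b' (take j z) (z ! j)) * (b' (take k z) (z ! k) - b (take k z) (z ! k)) *
        (\<Prod>j\<in>{Suc k..<length z}. b (take j z) (z ! j)) * u G' i z =
      (\<Sum>I\<in>cells. \<Sum>m\<in>mv I. if take k z \<in> I \<and> z ! k = m
         then W I * (q I m - p (i, G', I) m) * cf_weight F p i G' z k else 0)"
    if z: "z \<in> Z G'" and k: "k < length z" for z k
  proof (cases "ow (take k z)")
    case False
    then have "\<not> (take k z \<in> I)" if "I \<in> cells" for I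
      using cell_own that by blast
    then show ?thesis using False by (simp add: b'_eq)
  next
    case True
    have zH: "z \<in> H G'" using z by (simp add: Z_def)
    define I0 where "I0 = snd (F G' (take k z))"
    have Hi: "take k z \<in> Hi G' i" "fst (F G' (take k z)) = G'"
      using ow_Hi[OF take_in_nonterminal(1)[OF eg zH k]] True by auto
    have I0: "I0 \<in> cells" "take k z \<in> I0" "F G' (take k z) = (G', I0)"
      using own_cell[OF Hi] Hi by (auto simp: I0_def prod_eq_iff)
    have uniq: "take k z \<in> I \<longleftrightarrow> I = I0" if "I \<in> cells" for I
      using cell_own[OF that, of "take k z"] I0 by auto
    have m0: "z ! k \<in> mv I0"
      using take_in_nonterminal(2)[OF eg zH k] I0(2) by (auto simp: mv_def)
    \<comment> \<open>A sum over an infinite set is 0 by default, so a total mass of 1 forces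
      finiteness.\<close>
    have fin: "finite (mv I0)"
      using q_dist[OF I0(1)] by (auto simp: is_dist_def intro: ccontr)
    have finc: "finite cells"
      using finite_Info[OF eg] cells_Info by (meson finite_subset subsetI)
    \<comment> \<open>The own factors before \<open>k\<close> come from \<open>s\<close> and split
      off as the reaching weight; the remaining ones are those of \<open>cf_weight\<close>.\<close>
    have "own_weight (take k z) = (\<Prod>j<k. if ow (take j z) then s G' (take j z) (z ! j) else 1)"
      using k by (auto simp: own_weight_def min_def intro!: prod.cong)
    then have pre: "(\<Prod>j<k. b' (take j z) (z ! j)) =
        own_weight (take k z) * (\<Prod>j<k. if ow (take j z) then 1 else b (take j z) (z ! j))"
      unfolding b'_eq by (simp flip: prod.distrib) (intro prod.cong, auto)
    have b'_now: "b' (take k z) (z ! k) = q I0 (z ! k)"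
      using True q_eq[OF I0(1,2)] by (simp add: b'_eq)
    have b_now: "b (take k z) (z ! k) = p (i, G', I0) (z ! k)"
      using b_own[OF True] I0(3) by simp
    have cfw: "cf_weight F p i G' z k =
        (\<Prod>j<k. if ow (take j z) then 1 else b (take j z) (z ! j)) *
        (\<Prod>j\<in>{Suc k..<length z}. b (take j z) (z ! j)) * u G' i z"
      unfolding cf_weight_def ow_def b_def ..
    have "(\<Prod>j<k. b' (take j z) (z ! j)) * (b' (take k z) (z ! k) - b (take k z) (z ! k)) *
        (\<Prod>j\<in>{Suc k..<length z}. b (take j z) (z ! j)) * u G' i z =
        W I0 * (q I0 (z ! k) - p (i, G', I0) (z ! k)) * cf_weight F p i G' z k"
      unfolding pre b'_now b_now own_weight_W[OF I0(1,2)] cfw by (simp only: mult_ac)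
    also have "\<dots> = (\<Sum>I\<in>cells. if I = I0 then \<Sum>m\<in>mv I0. if m = z ! k
         then W I0 * (q I0 m - p (i, G', I0) m) * cf_weight F p i G' z k else 0 else 0)"
      using I0(1) m0 fin finc by simp
    also have "\<dots> = (\<Sum>I\<in>cells. \<Sum>m\<in>mv I. if take k z \<in> I \<and> z ! k = m
         then W I * (q I m - p (i, G', I) m) * cf_weight F p i G' z k else 0)"
      by (intro sum.cong refl) (auto simp: uniq intro!: sum.cong)
    finally show ?thesis .
  qed
  have "EU F \<sigma>' i G' - EU F (profile_of F p) i G' =
      (\<Sum>z\<in>Z G'. ((\<Prod>k<length z. b' (take k z) (z ! k)) - (\<Prod>k<length z. b (take k z) (z ! k))) * u G' i z)"
    by (simp add: EU_def run_prob_def b_def b'_def sum_subtractf left_diff_distrib)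
  \<comment> \<open>The deviation stands before \<open>k\<close> and the equilibrium after it. Hence
    \<open>s\<close> enters through the own weight and the choice at \<open>k\<close>, but not
    through the continuation.\<close>
  also have "\<dots> = (\<Sum>z\<in>Z G'. \<Sum>k<length z.
      (\<Prod>j<k. b' (take j z) (z ! j)) * (b' (take k z) (z ! k) - b (take k z) (z ! k)) *
        (\<Prod>j\<in>{Suc k..<length z}. b (take j z) (z ! j)) * u G' i z)"
    unfolding prod_diff_telescope sum_distrib_right ..
  also have "\<dots> = (\<Sum>z\<in>Z G'. \<Sum>k<length z. \<Sum>I\<in>cells. \<Sum>m\<in>mv I. if take k z \<in> I \<and> z ! k = m
         then W I * (q I m - p (i, G', I) m) * cf_weight F p i G' z k else 0)"
    using term_eq by (intro sum.cong) auto
  also have "\<dots> = (\<Sum>I\<in>cells. \<Sum>m\<in>mv I. \<Sum>z\<in>Z G'. \<Sum>k<length z. if take k z \<in> I \<and> z ! k = m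
         then W I * (q I m - p (i, G', I) m) * cf_weight F p i G' z k else 0)"
    by (rule sum_swap_dependent)
  also have "\<dots> = (\<Sum>I\<in>cells. \<Sum>m\<in>mv I. W I * (q I m - p (i, G', I) m) * cf_value F p (i, G', I) m)"
    unfolding cf_value_def by (simp add: sum_distrib_left if_distrib cong: if_cong)
  also have "\<dots> \<le> 0"
  proof (rule sum_nonpos)
    fix I assume I: "I \<in> cells"
    let ?c = "cf_value F p (i, G', I)"
    let ?avg = "\<Sum>m\<in>mv I. p (i, G', I) m * ?c m"
    \<comment> \<open>\<open>opt\<close> bounds each value by the equilibrium average
      \<open>?avg\<close>, so averaging the values with the distribution \<open>q I\<close> cannot
      exceed it.\<close>
    have "(\<Sum>m\<in>mv I. q I m * ?c m) \<le> (\<Sum>m\<in>mv I. q I m * ?avg)"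
      using q_dist[OF I] opt[OF cells_Info[OF I]]
      by (intro sum_mono mult_left_mono) (auto simp: is_dist_def mv_def)
    also have "\<dots> = ?avg"
      using q_dist[OF I] by (simp add: is_dist_def flip: sum_distrib_right)
    finally have "(\<Sum>m\<in>mv I. (q I m - p (i, G', I) m) * ?c m) \<le> 0"
      by (simp add: left_diff_distrib sum_subtractf)
    then have "W I * (\<Sum>m\<in>mv I. (q I m - p (i, G', I) m) * ?c m) \<le> 0"
      using W_nonneg[OF I] by (simp add: mult_nonneg_nonpos)
    then show "(\<Sum>m\<in>mv I. W I * (q I m - p (i, G', I) m) * ?c m) \<le> 0"
      by (simp add: sum_distrib_left mult.assoc)
  qed
  finally show ?thesis by (simp add: \<sigma>'_def)
qed

section \<open>Countably many agents and their equilibrium\<close>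

theorem theorem4p1:
  fixes G :: "('n, 'm) game" and GG :: "('n, 'm) aug set"
    and Gm :: "('n, 'm) aug" and F :: "('n, 'm) Fmap"
  assumes "extensive_game G"
    and "game_aou G GG Gm F"
  shows "\<exists>\<sigma>. gen_nash G GG F \<sigma>"
proof -
  note game = assms(2)
  note eg = game_aou_games(2)[OF game]
  \<comment> \<open>The condition \<open>i \<in> N G'\<close> makes the agents countable whatever
    the type of players; \<open>in_agents\<close> shows that every information set meets it, its
    members being nonterminal histories.\<close>
  define agents where "agents = {(i, G', I). G' \<in> GG \<and> i \<in> N G' \<and> I \<in> Info G' i}"
  define S where "S = (\<lambda>(i :: 'n, G' :: ('n, 'm) aug, I). \<Union> (moves G' ` I))"
  have in_agents: "(i, G', I) \<in> agents" if I: "G' \<in> GG" "I \<in> Info G' i" for i G' I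
  proof -
    obtain h where "h \<in> Hi G' i"
      using Info_subset_Hi[OF eg[OF I(1)] I(2)] Info_nonempty[OF eg[OF I(1)] I(2)] by blast
    then have "h \<in> H G' - Z G'" "P G' h = Player i" by (auto simp: Hi_def)
    moreover have "\<forall>h \<in> H G' - Z G'. P G' h \<in> Player ` N G' \<or> P G' h = Chance"
      using eg[OF I(1)] unfolding extensive_game_def by (elim conjE)
    ultimately have "Player i \<in> Player ` N G' \<or> Player i = Chance" by metis
    then have "i \<in> N G'" by auto
    then show ?thesis using I by (simp add: agents_def)
  qed
  have agents_countable: "countable agents"
  proof -
    have "agents = (\<Union>G'\<in>GG. \<Union>i\<in>N G'. (\<lambda>I. (i, G', I)) ` Info G' i)"
      by (auto simp: agents_def)
    moreover have "finite (N G')" if "G' \<in> GG" for G'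
      using eg[OF that] unfolding extensive_game_def by (elim conjE)
    ultimately show ?thesis
      using game_aou_games(1)[OF game] finite_Info[OF eg]
      by (auto intro!: countable_UN countable_image intro: countable_finite)
  qed
  have S_finite: "finite (S a)" and S_nonempty: "S a \<noteq> {}" if ag: "a \<in> agents" for a
  proof -
    obtain i G' I where a: "a = (i, G', I)" "G' \<in> GG" "I \<in> Info G' i"
      using ag by (auto simp: agents_def)
    obtain h where h: "h \<in> I" using Info_nonempty[OF eg[OF a(2)] a(3)] by blast
    have "S a = moves G' h"
      by (simp add: S_def a(1) UN_moves_Info[OF eg[OF a(2)] a(3) h])
    moreover have "h \<in> H G' - Z G'"
      using Info_subset_Hi[OF eg[OF a(2)] a(3)] h by (auto simp: Hi_def)
    ultimately show "finite (S a)" "S a \<noteq> {}"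
      using finite_moves[OF eg[OF a(2)], of h] moves_nonempty[OF eg[OF a(2)], of h] by auto
  qed
  have cf_lim: "(\<lambda>n. cf_value F (Y n) a m) \<longlonglongrightarrow> cf_value F y a m"
    if "a \<in> agents" "m \<in> S a" "\<And>b k. (\<lambda>n. Y n b k) \<longlonglongrightarrow> y b k" for Y y a m
    using that(3) by (rule cf_value_tendsto)
  note equilibrium = simplex_product_equilibrium[of agents S "cf_value F",
      OF agents_countable S_finite S_nonempty cf_lim]
  obtain p where p: "\<And>a. a \<in> agents \<Longrightarrow> is_dist (p a) (S a)"
    and opt: "\<And>a m. a \<in> agents \<Longrightarrow> m \<in> S a \<Longrightarrow>
      cf_value F p a m \<le> (\<Sum>k\<in>S a. p a k * cf_value F p a k)"
  proof (rule equilibrium)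
    fix p assume "\<And>a. a \<in> agents \<Longrightarrow> is_dist (p a) (S a)"
      and "\<And>a m. a \<in> agents \<Longrightarrow> m \<in> S a \<Longrightarrow>
        cf_value F p a m \<le> (\<Sum>k\<in>S a. p a k * cf_value F p a k)"
    then show thesis by (rule that)
  qed
  have "gen_nash G GG F (profile_of F p)"
    unfolding gen_nash_def gen_profile_def
  proof (intro conjI ballI allI impI)
    fix i G' assume "G' \<in> Games_of GG F i"
    show "local_strategy GG F i G' (profile_of F p i G')"
      unfolding local_strategy_def
    proof (intro conjI ballI impI)
      fix Gp h h' assume h: "Gp \<in> GG" "h \<in> Hi Gp i" "fst (F Gp h) = G'" "h' \<in> snd (F Gp h)"
      \<comment> \<open>\<open>h\<close> may lie in a game \<open>Gp\<close> other than
        \<open>G'\<close>; the distribution played there is that of the agent at the information set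
        \<open>I\<close> of \<open>G'\<close>.\<close>
      define I where "I = snd (F Gp h)"
      have I: "G' \<in> GG" "I \<in> Info G' i" "F Gp h = (G', I)"
        using game_aou_F(1,2)[OF game h(1,2)] h(3) by (auto simp: I_def prod_eq_iff)
      have "S (i, G', I) = moves G' h'"
        using UN_moves_Info[OF eg[OF I(1)] I(2)] h(4) by (simp add: S_def I_def)
      then show "is_dist (profile_of F p i G' Gp h) (moves G' h')"
        using p[OF in_agents[OF I(1,2)]] by (simp add: profile_of_def I(3))
    qed (auto simp: profile_of_def)
  next
    fix i G' s assume "G' \<in> Games_of GG F i" and s: "local_strategy GG F i G' s"
    then have G': "G' \<in> GG"
      using game_aou_F(1)[OF game] by (auto simp: Games_of_def)
    show "EU F ((profile_of F p)(i := (profile_of F p i)(G' := s))) i G' \<le> EU F (profile_of F p) i G'"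
      using opt[OF in_agents[OF G']]
      by (intro no_profitable_deviation[OF game G' s]) (auto simp: S_def)
  qed
  then show ?thesis by blast
qed

end
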